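(* In the setting described in the context, let $(F_0)_{ii}$ be a simple constant order Floquet exponent (i.e. $(F_0)_{jj}\neq(F_0)_{ii}$ for all $j\ne i$) and suppose that the first order perturbation $A_1$ has no constant component, that is, $A_1^{(0)}=0$. Then $(F_0)_{ii}$ is not perturbed linearly, but quadratically: the Floquet exponent $f_i(\epsilon)$ corresponding to $(F_0)_{ii}$ takes the form $$f_i(\epsilon)=(F_0)_{ii}+O(\epsilon^2).$$
   Context: Setting: $T>0$ and $A_\epsilon(t)=A_0+\epsilon A_1(t)+\epsilon^2A_2(t)+\ldots\in\mathbb{C}^{N\times N}$ is $T$-periodic and continuous in $t$, analytic in $\epsilon$ near $0$; $A_0$ is diagonal and constant in $t$; each $A_n(t)$, $n\ge1$, has a finite Fourier series $A_n(t)=\sum_m e^{2\pi \mathrm{i} mt/T}A_n^{(m)}$; the series converges for $|\epsilon|<r_0$ with $r_0$ independent of $t$. $F_0$ is the diagonal matrix with diagonal entries of $A_0-F_0$ in $\frac{2\pi \mathrm{i}}{T}\mathbb{Z}$ and imaginary parts of its diagonal entries in $(-\frac{\pi}{T},\frac{\pi}{T}]$; its diagonal entries are the constant order Floquet exponents. Let $X_\epsilon(t)=P_\epsilon(t)\exp(F_\epsilon t)$ be the decomposition of the fundamental solution ($X_\epsilon(0)=\mathrm{Id}$) of $\frac{dx}{dt}=A_\epsilon(t)x$ that is analytic in $\epsilon$, with $P_\epsilon$ being $T$-periodic in $t$, $P_\epsilon(0)=\mathrm{Id}$, $F_\epsilon=F_0+\epsilon F_1+\epsilon^2F_2+\ldots$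 and $P_\epsilon=P_0+\epsilon P_1+\ldots$, $P_0(t)=\exp((A_0-F_0)t)$. The Floquet exponents are the eigenvalues of $F_\epsilon$; $f_i(\epsilon)$ is the one with $f_i(0)=(F_0)_{ii}$.
   Formalization: The series for A_ε(t) is assumed to converge uniformly in t for each |ε|<r_0, not merely at each t with a common radius; with only pointwise convergence in t the claim can fail. *)

theory Defs
  imports "HOL-Analysis.Analysis" "HOL-Library.Landau_Symbols"
begin

text \<open>
  Square matrices are elements of \<open>complex^'n^'n\<close>, with product \<open>**\<close> and identity \<open>mat 1\<close>.
  The type-class operations \<open>*\<close>, \<open>^\<close>, \<open>1\<close> on this type are componentwise and
  are not used for matrices.
\<close>

definition mscale :: "complex \<Rightarrow> complex^'n^'n \<Rightarrow> complex^'n^'n"  (infixr "*k" 75)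
  where "c *k M = (\<chi> i j. c * M $ i $ j)"

definition is_diagonal :: "complex^'n^'n \<Rightarrow> bool"
  where "is_diagonal M \<longleftrightarrow> (\<forall>i j. i \<noteq> j \<longrightarrow> M $ i $ j = 0)"

definition is_eigenvalue :: "complex^'n^'n \<Rightarrow> complex \<Rightarrow> bool"
  where "is_eigenvalue M z \<longleftrightarrow> (\<exists>v. v \<noteq> 0 \<and> M *v v = z *s v)"

primrec mpow :: "complex^'n^'n \<Rightarrow> nat \<Rightarrow> complex^'n^'n"
  where
    "mpow M 0 = mat 1"
  | "mpow M (Suc k) = M ** mpow M k"

definition mexp :: "complex^'n^'n \<Rightarrow> complex^'n^'n"
  where "mexp M = (\<Sum>k. (1 / fact k) *k mpow M k)"

end

theory Submission
  imports Defs
begin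

text \<open>
  Since \<open>P\<close> has period \<open>T\<close> and starts at the identity, \<open>X \<epsilon> T\<close> is the exponential of \<open>T F \<epsilon>\<close>. An
  eigenvector \<open>v\<close> of \<open>F \<epsilon>\<close> for \<open>f \<epsilon>\<close> is therefore an eigenvector of the monodromy matrix, and the
  solution \<open>x\<close> with \<open>x 0 = v\<close> satisfies \<open>x T = exp (T * f \<epsilon>) *s v\<close>. So it suffices to control
  this one solution, normalised by \<open>norm v = 1\<close> in what follows, over one period.

  Remove the diagonal dynamics by \<open>y\<^sub>j t = exp (- A0\<^sub>j\<^sub>j t) x\<^sub>j t\<close>. Then \<open>y' = B y\<close> with \<open>B = O(\<epsilon>)\<close>
  on the period, so every component moves only by \<open>O(\<epsilon>)\<close> (\<open>slow_system_bound\<close>). On the other hand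
  \<open>y\<^sub>j T = m\<^sub>j y\<^sub>j 0\<close> with \<open>m\<^sub>j = exp (T (f \<epsilon> - F0\<^sub>j\<^sub>j))\<close>, because \<open>A0\<close> and \<open>F0\<close> differ by multiples of
  \<open>2 \<pi> \<i> / T\<close>. For \<open>j \<noteq> i\<close> the factor \<open>m\<^sub>j\<close> stays away from \<open>1\<close>: the diagonal entries of \<open>F0\<close> lie in a
  strip on which \<open>z \<mapsto> exp (T z)\<close> is injective (\<open>exp_multiplier_gap\<close>). Hence \<open>y\<^sub>j = O(\<epsilon>)\<close> for
  \<open>j \<noteq> i\<close>, so \<open>y\<^sub>i 0\<close> carries most of \<open>v\<close>, and
  \<open>y\<^sub>i' = \<epsilon> A1\<^sub>i\<^sub>i(t) y\<^sub>i 0 + O(\<epsilon>\<^sup>2)\<close>. A trigonometric polynomial without constant term has a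
  \<open>T\<close>-periodic primitive, so the leading term contributes nothing over a period and
  \<open>y\<^sub>i T - y\<^sub>i 0 = O(\<epsilon>\<^sup>2)\<close> (\<open>slow_system_averaged_component\<close>). Thus \<open>m\<^sub>i - 1 = O(\<epsilon>\<^sup>2)\<close>
  (\<open>slow_system_multiplier\<close>), and since \<open>f \<epsilon>\<close> tends to \<open>F0\<^sub>i\<^sub>i\<close>, the exponential can be undone near
  \<open>0\<close>: \<open>f \<epsilon> - F0\<^sub>i\<^sub>i = O(\<epsilon>\<^sup>2)\<close>.
\<close>

section \<open>Linear systems with small coefficients\<close>

lemma vector_derivative_norm_bound:
  fixes f :: "real \<Rightarrow> 'a::real_normed_vector"
  assumes "\<And>t. t \<in> {a..b} \<Longrightarrow> (f has_vector_derivative f' t) (at t within {a..b})"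
    and "\<And>t. t \<in> {a..b} \<Longrightarrow> norm (f' t) \<le> C"
    and "s \<in> {a..b}" "t \<in> {a..b}"
  shows "norm (f t - f s) \<le> C * \<bar>t - s\<bar>"
proof -
  have "norm (f t - f s) \<le> C * norm (t - s)"
  proof (rule differentiable_bound[where f' = "\<lambda>t h. h *\<^sub>R f' t"])
    show "onorm (\<lambda>h. h *\<^sub>R f' x) \<le> C" if "x \<in> {a..b}" for x
      using assms(2)[OF that] by (intro onorm_le) (simp add: mult.commute[of C] mult_left_mono)
    show "(f has_derivative (\<lambda>h. h *\<^sub>R f' x)) (at x within {a..b})" if "x \<in> {a..b}" for x
      using assms(1)[OF that] by (simp add: has_vector_derivative_def)
  qed (use assms(3,4) in auto)
  then show ?thesis by simp
qed

text \<open>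
  The maximum \<open>M\<close> of the \<open>l\<^sup>1\<close>-norm over the interval is attained by continuity, and every
  component moves by at most \<open>\<eta> M T\<close>. Summing gives \<open>M \<le> N + n \<eta> T M \<le> N + M / 2\<close>, where \<open>N\<close> is
  the initial norm and \<open>n\<close> the dimension, because \<open>n \<eta> T \<le> 1 / 2\<close>; so \<open>M \<le> 2 N\<close>.
\<close>

lemma slow_system_bound:
  fixes y :: "'n::finite \<Rightarrow> real \<Rightarrow> complex" and B :: "real \<Rightarrow> 'n \<Rightarrow> 'n \<Rightarrow> complex" and T \<eta> :: real
  assumes ode: "\<And>j t. t \<in> {0..T} \<Longrightarrow>
      (y j has_vector_derivative (\<Sum>k\<in>UNIV. B t j k * y k t)) (at t within {0..T})"
    and B: "\<And>t j k. t \<in> {0..T} \<Longrightarrow> norm (B t j k) \<le> \<eta>"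
    and T: "0 \<le> T" and small: "2 * (CARD('n) * \<eta> * T) \<le> 1"
    and t: "t \<in> {0..T}"
  shows "(\<Sum>k\<in>UNIV. norm (y k t)) \<le> 2 * (\<Sum>k\<in>UNIV. norm (y k 0))"
    and "norm (y j t - y j 0) \<le> 2 * \<eta> * T * (\<Sum>k\<in>UNIV. norm (y k 0))"
proof -
  define N where "N = (\<lambda>t. \<Sum>k\<in>UNIV. norm (y k t))"
  have \<eta>0: "\<eta> \<ge> 0" using order_trans[OF norm_ge_zero B[of 0]] T by simp
  have "continuous_on {0..T} (y k)" for k
    unfolding continuous_on_eq_continuous_within
    by (intro ballI has_vector_derivative_continuous[OF ode])
  then have "continuous_on {0..T} N"
    unfolding N_def by (intro continuous_intros)
  then obtain \<tau> where \<tau>: "\<tau> \<in> {0..T}" "\<And>s. s \<in> {0..T} \<Longrightarrow> N s \<le> N \<tau>"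
    using continuous_attains_sup[of "{0..T}" N] T by auto
  have deriv_bound: "norm (\<Sum>k\<in>UNIV. B s j k * y k s) \<le> \<eta> * N \<tau>" if "s \<in> {0..T}" for s j
  proof -
    have "norm (\<Sum>k\<in>UNIV. B s j k * y k s) \<le> (\<Sum>k\<in>UNIV. \<eta> * norm (y k s))"
      unfolding norm_mult[symmetric] using B[OF that]
      by (intro sum_norm_le) (simp add: norm_mult mult_right_mono)
    also have "\<dots> \<le> \<eta> * N \<tau>"
      using \<tau>(2)[OF that] \<eta>0 by (simp add: N_def sum_distrib_left[symmetric] mult_left_mono)
    finally show ?thesis .
  qed
  have inc: "norm (y j s - y j 0) \<le> \<eta> * N \<tau> * T" if s: "s \<in> {0..T}" for s j
  proof -
    have "norm (y j s - y j 0) \<le> \<eta> * N \<tau> * \<bar>s - 0\<bar>"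
      using T by (intro vector_derivative_norm_bound[OF ode deriv_bound] s) auto
    also have "\<dots> \<le> \<eta> * N \<tau> * T"
      using s \<eta>0 by (intro mult_left_mono) (auto simp: N_def sum_nonneg)
    finally show ?thesis .
  qed
  have "N \<tau> \<le> (\<Sum>k\<in>UNIV. norm (y k 0) + \<eta> * N \<tau> * T)"
    unfolding N_def
  proof (rule sum_mono)
    fix k
    show "norm (y k \<tau>) \<le> norm (y k 0) + \<eta> * (\<Sum>k\<in>UNIV. norm (y k \<tau>)) * T"
      using inc[OF \<tau>(1), of k] norm_triangle_ineq2[of "y k \<tau>" "y k 0"] by (simp add: N_def)
  qed
  also have "\<dots> = N 0 + (CARD('n) * \<eta> * T) * N \<tau>"
    by (simp add: sum.distrib N_def)
  also have "\<dots> \<le> N 0 + 1/2 * N \<tau>"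
    using small by (intro add_left_mono mult_right_mono) (auto simp: N_def sum_nonneg)
  finally have N\<tau>: "N \<tau> \<le> 2 * N 0" by simp
  then show "(\<Sum>k\<in>UNIV. norm (y k t)) \<le> 2 * (\<Sum>k\<in>UNIV. norm (y k 0))"
    using \<tau>(2)[OF t] by (simp add: N_def)
  have "\<eta> * N \<tau> * T \<le> \<eta> * (2 * N 0) * T"
    using N\<tau> \<eta>0 T by (intro mult_right_mono mult_left_mono) auto
  then show "norm (y j t - y j 0) \<le> 2 * \<eta> * T * (\<Sum>k\<in>UNIV. norm (y k 0))"
    using inc[OF t, of j] by (simp add: N_def mult_ac)
qed

text \<open>
  The diagonal coefficient \<open>B\<^sub>i\<^sub>i\<close> equals, up to \<open>\<rho>\<close>, the derivative of a function \<open>a\<close> that returns to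
  its initial value. Subtracting \<open>a(t) y\<^sub>i 0\<close> from \<open>y\<^sub>i\<close> keeps the increment over the whole interval
  and removes the only term of order \<open>\<eta> y\<^sub>i 0\<close> from the derivative. What remains is quadratic in \<open>\<eta>\<close>,
  or of size \<open>\<rho>\<close>, or driven by the initial values of the other components.
\<close>

lemma slow_system_averaged_component:
  fixes y :: "'n::finite \<Rightarrow> real \<Rightarrow> complex" and B :: "real \<Rightarrow> 'n \<Rightarrow> 'n \<Rightarrow> complex" and T \<eta> \<rho> :: real
  assumes ode: "\<And>j t. t \<in> {0..T} \<Longrightarrow>
      (y j has_vector_derivative (\<Sum>k\<in>UNIV. B t j k * y k t)) (at t within {0..T})"
    and B: "\<And>t j k. t \<in> {0..T} \<Longrightarrow> norm (B t j k) \<le> \<eta>"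
    and T: "0 \<le> T" and small: "2 * (CARD('n) * \<eta> * T) \<le> 1"
    and a: "\<And>t. t \<in> {0..T} \<Longrightarrow> (a has_vector_derivative a' t) (at t within {0..T})"
    and a_return: "a T = a 0"
    and a'_bound: "\<And>t. t \<in> {0..T} \<Longrightarrow> norm (a' t) \<le> \<eta>"
    and a'_approx: "\<And>t. t \<in> {0..T} \<Longrightarrow> norm (B t i i - a' t) \<le> \<rho>"
  shows "norm (y i T - y i 0) \<le> T * (\<eta> * (\<Sum>k\<in>-{i}. norm (y k 0))
           + (2 * CARD('n) * T * \<eta>\<^sup>2 + 2 * \<rho>) * (\<Sum>k\<in>UNIV. norm (y k 0)))"
proof -
  define N where "N = (\<Sum>k\<in>UNIV. norm (y k 0))"
  define O' where "O' = (\<Sum>k\<in>-{i}. norm (y k 0))"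
  have \<eta>0: "\<eta> \<ge> 0" using order_trans[OF norm_ge_zero B[of 0]] T by simp
  have \<rho>0: "\<rho> \<ge> 0" using order_trans[OF norm_ge_zero a'_approx[of 0]] T by simp
  have slow: "(\<Sum>k\<in>UNIV. norm (y k t)) \<le> 2 * N" "norm (y j t - y j 0) \<le> 2 * \<eta> * T * N"
    if "t \<in> {0..T}" for t j
    using slow_system_bound[of T y B \<eta> t] ode B T small that unfolding N_def by blast+
  define z where "z = (\<lambda>t. y i t - a t * y i 0)"
  define z' where "z' = (\<lambda>t. (\<Sum>k\<in>UNIV. B t i k * y k t) - a' t * y i 0)"
  have z: "(z has_vector_derivative z' t) (at t within {0..T})" if "t \<in> {0..T}" for t
    unfolding z_def z'_def
    by (intro has_vector_derivative_diff has_vector_derivative_mult_left ode a that)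
  have z'_bound: "norm (z' t) \<le> \<eta> * O' + (2 * CARD('n) * T * \<eta>\<^sup>2 + 2 * \<rho>) * N"
    if t: "t \<in> {0..T}" for t
  proof -
    have UNIV_eq: "UNIV = insert i (-{i})" by auto
    have card: "card (-{i}) + 1 = CARD('n)"
      by (subst UNIV_eq, subst card_insert_disjoint) auto
    have "z' t = (\<Sum>k\<in>-{i}. B t i k * y k t) + a' t * (y i t - y i 0) + (B t i i - a' t) * y i t"
      unfolding z'_def by (subst UNIV_eq, subst sum.insert) (auto simp: algebra_simps)
    moreover have "norm (u + v + w) \<le> norm u + norm v + norm w" for u v w :: complex
      using norm_triangle_ineq[of "u + v" w] norm_triangle_ineq[of u v] by linarith
    ultimately have split: "norm (z' t) \<le> norm (\<Sum>k\<in>-{i}. B t i k * y k t)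
        + norm (a' t * (y i t - y i 0)) + norm ((B t i i - a' t) * y i t)"
      by presburger
    have off1: "norm (\<Sum>k\<in>-{i}. B t i k * y k t) \<le> (\<Sum>k\<in>-{i}. \<eta> * (norm (y k 0) + 2 * \<eta> * T * N))"
    proof (rule sum_norm_le)
      fix k
      have "norm (y k t) \<le> norm (y k 0) + 2 * \<eta> * T * N"
        using slow(2)[OF t, of k] norm_triangle_ineq2[of "y k t" "y k 0"] by simp
      then show "norm (B t i k * y k t) \<le> \<eta> * (norm (y k 0) + 2 * \<eta> * T * N)"
        unfolding norm_mult using B[OF t] \<eta>0 by (intro mult_mono) auto
    qed
    have off2: "(\<Sum>k\<in>-{i}. \<eta> * (norm (y k 0) + 2 * \<eta> * T * N))
        = \<eta> * O' + card (-{i}) * (2 * \<eta>\<^sup>2 * T * N)"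
      by (simp add: sum_distrib_left[symmetric] sum.distrib O'_def power2_eq_square algebra_simps)
    have diag: "norm (a' t * (y i t - y i 0)) \<le> \<eta> * (2 * \<eta> * T * N)"
      unfolding norm_mult using a'_bound[OF t] slow(2)[OF t] \<eta>0 by (intro mult_mono) auto
    have "norm (y i t) \<le> 2 * N"
      using slow(1)[OF t] member_le_sum[of i UNIV "\<lambda>k. norm (y k t)"] by simp
    then have rest: "norm ((B t i i - a' t) * y i t) \<le> \<rho> * (2 * N)"
      unfolding norm_mult using a'_approx[OF t] \<rho>0 by (intro mult_mono) auto
    have "norm (z' t) \<le> \<eta> * O' + card (-{i}) * (2 * \<eta>\<^sup>2 * T * N) + \<eta> * (2 * \<eta> * T * N) + \<rho> * (2 * N)"
      using split off1 diag rest unfolding off2 by linarith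
    also have "\<dots> = \<eta> * O' + real (card (-{i}) + 1) * (2 * \<eta>\<^sup>2 * T * N) + 2 * \<rho> * N"
      by (simp add: algebra_simps power2_eq_square)
    finally have "norm (z' t) \<le> \<eta> * O' + real (card (-{i}) + 1) * (2 * \<eta>\<^sup>2 * T * N) + 2 * \<rho> * N" .
    then show ?thesis unfolding card by (simp add: algebra_simps)
  qed
  have "norm (z T - z 0) \<le> (\<eta> * O' + (2 * CARD('n) * T * \<eta>\<^sup>2 + 2 * \<rho>) * N) * \<bar>T - 0\<bar>"
    using T by (intro vector_derivative_norm_bound[OF z z'_bound]) auto
  moreover have "z T - z 0 = y i T - y i 0"
    by (simp add: z_def a_return)
  ultimately show ?thesis
    using T by (simp add: N_def O'_def mult.commute)
qed

text \<open>
  If \<open>y\<^sub>j\<close> is multiplied over the interval by a factor \<open>m\<^sub>j\<close> at distance at least \<open>c\<close> from \<open>1\<close>, then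
  \<open>c \<bar>y\<^sub>j 0\<bar> \<le> \<bar>y\<^sub>j T - y\<^sub>j 0\<bar> = O(\<eta> N)\<close>, where \<open>N\<close> is the
  initial norm. When this holds for all \<open>j \<noteq> i\<close>, the component \<open>i\<close> has at
  least half of the initial norm, and its increment is second order by \<open>slow_system_averaged_component\<close>; dividing
  by it bounds \<open>m\<^sub>i - 1\<close>.
\<close>

lemma slow_system_multiplier:
  fixes y :: "'n::finite \<Rightarrow> real \<Rightarrow> complex" and B :: "real \<Rightarrow> 'n \<Rightarrow> 'n \<Rightarrow> complex" and T \<eta> \<rho> c :: real
  assumes ode: "\<And>j t. t \<in> {0..T} \<Longrightarrow>
      (y j has_vector_derivative (\<Sum>k\<in>UNIV. B t j k * y k t)) (at t within {0..T})"
    and B: "\<And>t j k. t \<in> {0..T} \<Longrightarrow> norm (B t j k) \<le> \<eta>"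
    and T: "0 \<le> T" and small: "2 * (CARD('n) * \<eta> * T) \<le> 1"
    and a: "\<And>t. t \<in> {0..T} \<Longrightarrow> (a has_vector_derivative a' t) (at t within {0..T})"
    and a_return: "a T = a 0"
    and a'_bound: "\<And>t. t \<in> {0..T} \<Longrightarrow> norm (a' t) \<le> \<eta>"
    and a'_approx: "\<And>t. t \<in> {0..T} \<Longrightarrow> norm (B t i i - a' t) \<le> \<rho>"
    and return: "\<And>j. y j T = m j * y j 0"
    and nonzero: "y l 0 \<noteq> 0"
    and gap: "c > 0" "\<And>j. j \<noteq> i \<Longrightarrow> c \<le> norm (m j - 1)"
    and small_gap: "4 * (CARD('n) * \<eta> * T) \<le> c"
  shows "norm (m i - 1) \<le> 4 * T * (CARD('n) * T * (1 + 1 / c) * \<eta>\<^sup>2 + \<rho>)"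
proof -
  define N where "N = (\<Sum>k\<in>UNIV. norm (y k 0))"
  define O' where "O' = (\<Sum>k\<in>-{i}. norm (y k 0))"
  have \<eta>0: "\<eta> \<ge> 0" using order_trans[OF norm_ge_zero B[of 0]] T by simp
  have "norm (y l 0) \<le> N"
    unfolding N_def by (intro member_le_sum) auto
  then have N: "N > 0" using nonzero by (simp add: less_le_trans[OF _ \<open>norm (y l 0) \<le> N\<close>])
  have ret: "norm (m j - 1) * norm (y j 0) = norm (y j T - y j 0)" for j
    by (simp add: return norm_mult[symmetric] algebra_simps)
  have "norm (y j 0) \<le> 2 * \<eta> * T * N / c" if "j \<noteq> i" for j
  proof -
    have "c * norm (y j 0) \<le> norm (m j - 1) * norm (y j 0)"
      using gap(2)[OF that] by (rule mult_right_mono) simp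
    also have "\<dots> \<le> 2 * \<eta> * T * N"
      unfolding ret N_def using T by (intro slow_system_bound(2)[OF ode B T small]) auto
    finally show ?thesis using gap(1) by (simp add: field_simps)
  qed
  then have "O' \<le> card (-{i}) * (2 * \<eta> * T * N / c)"
    unfolding O'_def by (intro sum_bounded_above) auto
  also have "\<dots> \<le> CARD('n) * (2 * \<eta> * T * N / c)"
    using \<eta>0 T N gap(1) by (intro mult_right_mono) (auto simp: card_mono)
  finally have off: "O' \<le> CARD('n) * (2 * \<eta> * T * N / c)" .
  also have "\<dots> = (4 * (CARD('n) * \<eta> * T)) * N / (2 * c)" by simp
  also have "\<dots> \<le> c * N / (2 * c)"
    using small_gap N gap(1) by (intro divide_right_mono mult_right_mono) auto
  finally have "O' \<le> N / 2" using gap(1) by simp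
  moreover have "N = norm (y i 0) + O'"
    using sum.remove[of UNIV i "\<lambda>k. norm (y k 0)"] by (simp add: N_def O'_def Compl_eq_Diff_UNIV)
  ultimately have yi: "N / 2 \<le> norm (y i 0)" by simp
  have "norm (m i - 1) * (N / 2) \<le> norm (m i - 1) * norm (y i 0)"
    using yi by (intro mult_left_mono) auto
  also have "\<dots> \<le> T * (\<eta> * O' + (2 * CARD('n) * T * \<eta>\<^sup>2 + 2 * \<rho>) * N)"
    unfolding ret N_def O'_def
    by (intro slow_system_averaged_component[OF ode B T small a a_return a'_bound a'_approx])
  also have "\<dots> \<le> T * (\<eta> * (CARD('n) * (2 * \<eta> * T * N / c)) + (2 * CARD('n) * T * \<eta>\<^sup>2 + 2 * \<rho>) * N)"
    using off \<eta>0 T by (intro mult_left_mono add_right_mono) auto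
  also have "\<dots> = 4 * T * (CARD('n) * T * (1 + 1 / c) * \<eta>\<^sup>2 + \<rho>) * (N / 2)"
    by (simp add: algebra_simps power2_eq_square add_divide_distrib)
  finally show ?thesis using N by (simp only: mult_le_cancel_right)
qed

section \<open>Uniform second-order remainder of a power series\<close>

text \<open>
  Uniform convergence at the single radius \<open>\<rho> = r / 2\<close> makes all but finitely many of the terms
  \<open>\<rho> ^ n * g n s\<close> bounded by \<open>1\<close> uniformly in \<open>s\<close>, and boundedness of each coefficient takes care of
  the others. These are Cauchy estimates uniform in \<open>s\<close>; for \<open>\<bar>\<epsilon>\<bar> \<le> \<rho> / 2\<close> the tail from \<open>n = 2\<close> on
  is then dominated by a geometric series of ratio at most \<open>1 / 2\<close>.
\<close>

lemma uniform_power_series_remainder: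
  fixes g :: "nat \<Rightarrow> 's \<Rightarrow> complex" and h :: "complex \<Rightarrow> 's \<Rightarrow> complex"
  assumes r: "r > 0"
    and lim: "\<And>\<epsilon>. norm \<epsilon> < r \<Longrightarrow> uniform_limit UNIV (\<lambda>k s. \<Sum>n<k. \<epsilon> ^ n * g n s) (h \<epsilon>) sequentially"
    and bdd: "\<And>n. \<exists>b. \<forall>s. norm (g n s) \<le> b"
  obtains C where "C > 0"
    and "\<And>\<epsilon> s. norm \<epsilon> \<le> r / 4 \<Longrightarrow> norm (h \<epsilon> s - g 0 s - \<epsilon> * g 1 s) \<le> C * (norm \<epsilon>)\<^sup>2"
proof -
  obtain b where b: "\<And>n s. norm (g n s) \<le> b n" using bdd by metis
  have b0: "b n \<ge> 0" for n by (rule order_trans[OF norm_ge_zero b])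
  define \<rho> where "\<rho> = r / 2"
  have \<rho>: "\<rho> > 0" "norm (complex_of_real \<rho>) < r" using r by (auto simp: \<rho>_def)
  obtain m where m: "\<And>k s. k \<ge> m \<Longrightarrow>
      dist (\<Sum>n<k. complex_of_real \<rho> ^ n * g n s) (h (of_real \<rho>) s) < 1 / 2"
    using uniform_limitD[OF lim[OF \<rho>(2)], of "1/2"] unfolding eventually_sequentially by auto
  define C0 where "C0 = 1 + (\<Sum>n<m. \<rho> ^ n * b n)"
  have sum0: "(\<Sum>n<m. \<rho> ^ n * b n) \<ge> 0" using b0 \<rho>(1) by (intro sum_nonneg) auto
  then have C0: "C0 \<ge> 1" by (simp add: C0_def)
  have coeff: "\<rho> ^ n * norm (g n s) \<le> C0" for n s
  proof (cases "n < m")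
    case True
    have "\<rho> ^ n * norm (g n s) \<le> \<rho> ^ n * b n" using b \<rho>(1) by (intro mult_left_mono) auto
    also have "\<dots> \<le> (\<Sum>n<m. \<rho> ^ n * b n)"
      using True b0 \<rho>(1) by (intro member_le_sum) auto
    finally show ?thesis by (simp add: C0_def)
  next
    case False
    then have "dist (\<Sum>n<Suc n. complex_of_real \<rho> ^ n * g n s) (\<Sum>n<n. complex_of_real \<rho> ^ n * g n s) < 1"
      by (intro dist_triangle_half_l[OF m m]) auto
    then have "norm (complex_of_real \<rho> ^ n * g n s) < 1" by (simp add: dist_norm)
    then show ?thesis using C0 \<rho>(1) by (simp add: norm_mult norm_power)
  qed
  show ?thesis
  proof (rule that[of "2 * C0 / \<rho>\<^sup>2"])
    show "2 * C0 / \<rho>\<^sup>2 > 0" using C0 \<rho>(1) by simp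
    fix \<epsilon> :: complex and s
    assume \<epsilon>: "norm \<epsilon> \<le> r / 4"
    define q where "q = norm \<epsilon> / \<rho>"
    have q: "0 \<le> q" "q \<le> 1 / 2" using \<epsilon> r by (auto simp: q_def \<rho>_def field_simps)
    have "(\<lambda>n. \<epsilon> ^ n * g n s) sums h \<epsilon> s"
      unfolding sums_def using \<epsilon> r by (intro tendsto_uniform_limitI[OF lim]) auto
    then have "(\<lambda>n. \<epsilon> ^ (n + 2) * g (n + 2) s) sums (h \<epsilon> s - (\<Sum>n<2. \<epsilon> ^ n * g n s))"
      by (rule sums_split_initial_segment)
    moreover have "h \<epsilon> s - (\<Sum>n<2. \<epsilon> ^ n * g n s) = h \<epsilon> s - g 0 s - \<epsilon> * g 1 s"
      by (simp add: numeral_2_eq_2)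
    ultimately have tail: "(\<lambda>n. \<epsilon> ^ (n + 2) * g (n + 2) s) sums (h \<epsilon> s - g 0 s - \<epsilon> * g 1 s)"
      by simp
    have geo: "(\<lambda>n. C0 * q\<^sup>2 * q ^ n) sums (C0 * q\<^sup>2 * (1 / (1 - q)))"
      using q by (intro sums_mult geometric_sums) auto
    have "norm (\<epsilon> ^ (n + 2) * g (n + 2) s) \<le> C0 * q\<^sup>2 * q ^ n" for n
    proof -
      have "norm (\<epsilon> ^ (n + 2) * g (n + 2) s) = q ^ (n + 2) * (\<rho> ^ (n + 2) * norm (g (n + 2) s))"
        using \<rho>(1) unfolding q_def by (simp only: norm_mult norm_power power_divide) simp
      also have "\<dots> \<le> q ^ (n + 2) * C0"
        using q(1) by (intro mult_left_mono coeff) simp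
      finally show ?thesis by (simp add: power_add power2_eq_square mult_ac)
    qed
    then have "norm (\<Sum>n. \<epsilon> ^ (n + 2) * g (n + 2) s) \<le> (\<Sum>n. C0 * q\<^sup>2 * q ^ n)"
      using geo by (intro norm_suminf_le) (auto simp: sums_iff)
    also have "\<dots> = C0 * q\<^sup>2 * (1 / (1 - q))" using geo by (simp add: sums_iff)
    also have "\<dots> \<le> C0 * q\<^sup>2 * 2"
      using q C0 by (intro mult_left_mono) (auto simp: field_simps)
    finally have "norm (h \<epsilon> s - g 0 s - \<epsilon> * g 1 s) \<le> C0 * q\<^sup>2 * 2"
      using tail by (simp add: sums_iff)
    then show "norm (h \<epsilon> s - g 0 s - \<epsilon> * g 1 s) \<le> 2 * C0 / \<rho>\<^sup>2 * (norm \<epsilon>)\<^sup>2"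
      by (simp add: q_def power_divide mult_ac)
  qed
qed

section \<open>The matrix exponential on eigenvectors\<close>

lemma mscale_nth [simp]: "(c *k M) $ j $ k = c * M $ j $ k"
  by (simp add: mscale_def)

lemma norm_matrix_le_sum_entries:
  fixes M :: "complex^'m^'n"
  shows "norm M \<le> (\<Sum>j\<in>UNIV. \<Sum>k\<in>UNIV. norm (M $ j $ k))"
proof -
  have "norm M \<le> (\<Sum>j\<in>UNIV. norm (M $ j))"
    unfolding norm_vec_def by (intro L2_set_le_sum) auto
  also have "\<dots> \<le> (\<Sum>j\<in>UNIV. \<Sum>k\<in>UNIV. norm (M $ j $ k))"
    by (intro sum_mono, subst norm_vec_def, intro L2_set_le_sum) auto
  finally show ?thesis .
qed

lemma norm_matrix_entry_le: "norm ((M :: complex^'m^'n) $ j $ k) \<le> norm M"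
  by (rule order_trans[OF Finite_Cartesian_Product.norm_nth_le Finite_Cartesian_Product.norm_nth_le])

lemma norm_mpow_entry_le:
  fixes M :: "complex^'n^'n"
  shows "norm (mpow M p $ j $ k) \<le> (CARD('n) * norm M) ^ p"
proof (induction p arbitrary: j)
  case 0
  show ?case by (simp add: mat_def)
next
  case (Suc p)
  have "norm (mpow M (Suc p) $ j $ k) \<le> (\<Sum>l\<in>(UNIV::'n set). norm M * (CARD('n) * norm M) ^ p)"
    unfolding mpow.simps matrix_matrix_mult_def vec_lambda_beta
    by (intro sum_norm_le) (auto simp: norm_mult intro!: mult_mono norm_matrix_entry_le Suc.IH)
  then show ?case by simp
qed

text \<open>
  The entries of \<open>mpow M p\<close> grow at most like \<open>(n * norm M) ^ p\<close>, with \<open>n\<close> the dimension, so the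
  scalar exponential series is a majorant.
\<close>

lemma mexp_summable: "summable (\<lambda>p. (1 / fact p) *k mpow (M :: complex^'n^'n) p)"
proof (rule summable_comparison_test)
  let ?q = "CARD('n) * norm M"
  show "\<exists>K. \<forall>p\<ge>K. norm ((1 / fact p) *k mpow M p) \<le> (CARD('n))\<^sup>2 * (?q ^ p /\<^sub>R fact p)"
  proof (intro exI allI impI)
    fix p :: nat
    have "norm ((1 / fact p) *k mpow M p) \<le> (\<Sum>j\<in>(UNIV::'n set). \<Sum>k\<in>(UNIV::'n set). ?q ^ p / fact p)"
    proof (rule order_trans[OF norm_matrix_le_sum_entries], intro sum_mono)
      fix j k
      show "norm (((1 / fact p) *k mpow M p) $ j $ k) \<le> ?q ^ p / fact p"
        using norm_mpow_entry_le[of M p j k]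
        by (simp add: norm_mult norm_divide divide_right_mono)
    qed
    then show "norm ((1 / fact p) *k mpow M p) \<le> (CARD('n))\<^sup>2 * (?q ^ p /\<^sub>R fact p)"
      by (simp add: power2_eq_square field_simps)
  qed
  show "summable (\<lambda>p. (CARD('n))\<^sup>2 * (?q ^ p /\<^sub>R fact p))"
    by (intro summable_mult summable_exp_generic)
qed

lemma bounded_linear_matrix_vector_mult_left: "bounded_linear (\<lambda>M :: complex^'n^'m. M *v v)"
proof -
  have "linear (\<lambda>M :: complex^'n^'m. M *v v)"
    by (rule linearI) (simp_all add: matrix_vector_mult_def vec_eq_iff sum.distrib distrib_right scaleR_sum_right)
  then show ?thesis by (simp add: linear_conv_bounded_linear)
qed

lemma mexp_eigenvector:
  fixes M :: "complex^'n^'n"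
  assumes "M *v v = z *s v"
  shows "mexp M *v v = exp z *s v"
proof -
  have pow: "mpow M p *v v = z ^ p *s v" for p
  proof (induction p)
    case (Suc p)
    have "mpow M (Suc p) *v v = M *v (z ^ p *s v)"
      by (simp add: matrix_vector_mul_assoc[symmetric] Suc.IH)
    also have "\<dots> = z ^ p *s (M *v v)"
      by (simp add: vector_scalar_commute)
    finally show ?case by (simp add: assms vector_smult_assoc mult.commute)
  qed simp
  have "bounded_linear (\<lambda>M :: complex^'n^'n. (M *v v) $ j)" for j
    by (intro bounded_linear_compose[OF bounded_linear_vec_nth bounded_linear_matrix_vector_mult_left])
  moreover have "(\<lambda>p. (1 / fact p) *k mpow M p) sums mexp M"
    unfolding mexp_def by (intro summable_sums mexp_summable)
  ultimately have "(\<lambda>p. (((1 / fact p) *k mpow M p) *v v) $ j) sums (mexp M *v v) $ j" for j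
    by (rule bounded_linear.sums)
  moreover have "(((1 / fact p) *k mpow M p) *v v) $ j = z ^ p /\<^sub>R fact p * v $ j" for p j
  proof -
    have "(((1 / fact p) *k mpow M p) *v v) $ j = 1 / fact p * (mpow M p *v v) $ j"
      by (simp add: matrix_vector_mult_def sum_distrib_left mult_ac)
    then show ?thesis by (simp add: pow scaleR_conv_of_real field_simps)
  qed
  ultimately have "(\<lambda>p. z ^ p /\<^sub>R fact p * v $ j) sums (mexp M *v v) $ j" for j
    by simp
  moreover have "(\<lambda>p. z ^ p /\<^sub>R fact p * v $ j) sums (exp z * v $ j)" for j
    by (intro sums_mult2 exp_converges)
  ultimately show ?thesis
    by (simp add: vec_eq_iff) (metis sums_unique2)
qed

section \<open>Zero-mean trigonometric polynomials and the scalar exponential\<close>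

text \<open>
  Without the zero mode every frequency can be divided by, so the termwise primitive is again a
  trigonometric polynomial of period \<open>T\<close>. This is where the vanishing of the constant Fourier
  component enters.
\<close>

lemma trigonometric_polynomial_primitive:
  fixes c :: "int \<Rightarrow> complex"
  assumes T: "T > 0" and zero: "0 \<notin> S"
  obtains a :: "real \<Rightarrow> complex"
  where "\<And>t. (a has_vector_derivative (\<Sum>m\<in>S. exp (2 * pi * \<i> * of_int m * t / T) * c m)) (at t)"
    and "a T = a 0"
proof
  define \<omega> where "\<omega> = (\<lambda>m::int. 2 * pi * \<i> * of_int m / T)"
  define a where "a = (\<lambda>t. \<Sum>m\<in>S. exp (\<omega> m * complex_of_real t) / \<omega> m * c m)"
  show "(a has_vector_derivative (\<Sum>m\<in>S. exp (2 * pi * \<i> * of_int m * t / T) * c m)) (at t)" for t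
    unfolding a_def
  proof (rule has_vector_derivative_sum)
    fix m assume "m \<in> S"
    then have nz: "\<omega> m \<noteq> 0" using zero T by (auto simp: \<omega>_def)
    have "((\<lambda>z. exp (\<omega> m * z) / \<omega> m * c m) has_field_derivative exp (\<omega> m * of_real t) * c m) (at (of_real t))"
      using nz by (auto intro!: derivative_eq_intros)
    from has_vector_derivative_real_field[OF this]
    show "((\<lambda>t. exp (\<omega> m * complex_of_real t) / \<omega> m * c m)
        has_vector_derivative exp (2 * pi * \<i> * of_int m * t / T) * c m) (at t)"
      by (simp add: \<omega>_def)
  qed
  have "exp (\<omega> m * complex_of_real T) = 1" for m
  proof -
    have "\<omega> m * complex_of_real T = 2 * of_int m * pi * \<i>" using T by (simp add: \<omega>_def)
    then show ?thesis using exp_integer_2pi[of "of_int m"] by (metis Ints_of_int)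
  qed
  then show "a T = a 0" by (simp add: a_def)
qed

lemma norm_le_norm_exp_minus_one:
  obtains r where "r > 0" and "\<And>w::complex. norm w < r \<Longrightarrow> norm w \<le> 2 * norm (exp w - 1)"
proof -
  have "((\<lambda>w::complex. (exp w - 1) / w) \<longlongrightarrow> 1) (at 0)"
    using DERIV_D[OF DERIV_exp[of "0::complex"]] by simp
  then obtain r where r: "r > 0" "\<And>w::complex. w \<noteq> 0 \<Longrightarrow> norm w < r \<Longrightarrow> norm ((exp w - 1) / w - 1) < 1 / 2"
    unfolding LIM_eq by (auto dest!: spec[of _ "1 / 2 :: real"])
  show ?thesis
  proof (rule that[OF r(1)])
    fix w :: complex assume w: "norm w < r"
    show "norm w \<le> 2 * norm (exp w - 1)"
    proof (cases "w = 0")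
      case False
      have "1 / 2 \<le> norm ((exp w - 1) / w)"
        using r(2)[OF False w] norm_triangle_ineq3[of "(exp w - 1) / w" 1] by simp
      then show ?thesis using False by (simp add: norm_divide field_simps)
    qed simp
  qed
qed


lemma exp_strip_inj:
  assumes T: "T > 0"
    and "Im z \<in> {- pi / T <.. pi / T}" "Im w \<in> {- pi / T <.. pi / T}"
    and "exp (complex_of_real T * z) = exp (complex_of_real T * w)"
  shows "z = w"
proof -
  have "complex_of_real T * z = complex_of_real T * w"
  proof (rule exp_complex_eqI)
    have "Im z * T \<in> {-pi<..pi}" "Im w * T \<in> {-pi<..pi}"
      using assms(2,3) T by (auto simp: field_simps)
    then show "\<bar>Im (complex_of_real T * z) - Im (complex_of_real T * w)\<bar> < 2 * pi"
      by (auto simp: mult.commute abs_less_iff)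
  qed (use assms(4) in simp)
  then show ?thesis using T by simp
qed

text \<open>
  Distinct points of the half-open strip have distinct exponentials, so each limit
  \<open>exp (T (d i - d j)) - 1\<close> is nonzero; half of the smallest modulus is a common lower bound near \<open>0\<close>.
\<close>

lemma exp_multiplier_gap:
  fixes f :: "complex \<Rightarrow> complex" and d :: "'n::finite \<Rightarrow> complex"
  assumes T: "T > 0" and cont: "isCont f 0" and f0: "f 0 = d i"
    and strip: "\<And>j. Im (d j) \<in> {- pi / T <.. pi / T}"
    and simple: "\<And>j. j \<noteq> i \<Longrightarrow> d j \<noteq> d i"
  obtains c where "c > 0"
    and "\<forall>\<^sub>F \<epsilon> in nhds 0. \<forall>j\<in>-{i}. c \<le> norm (exp (complex_of_real T * (f \<epsilon> - d j)) - 1)"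
proof -
  define w where "w = (\<lambda>j. norm (exp (complex_of_real T * (d i - d j)) - 1))"
  \<comment> \<open>Inserting \<open>1\<close> keeps the minimum meaningful when \<open>i\<close> is the only index.\<close>
  define c where "c = Min (insert 1 (w ` (-{i}))) / 2"
  have w: "w j > 0" if "j \<noteq> i" for j
  proof -
    have "exp (complex_of_real T * d i) \<noteq> exp (complex_of_real T * d j)"
      using exp_strip_inj[OF T strip strip] simple[OF that] by metis
    then show ?thesis by (simp add: w_def right_diff_distrib exp_diff)
  qed
  then have c: "c > 0" by (auto simp: c_def)
  have "\<forall>\<^sub>F \<epsilon> in nhds 0. c \<le> norm (exp (complex_of_real T * (f \<epsilon> - d j)) - 1)" if "j \<in> -{i}" for j
  proof -
    have "Min (insert 1 (w ` (-{i}))) \<le> w j" using that by (intro Min_le) auto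
    then have cw: "c < w j" using c unfolding c_def by linarith
    have "((\<lambda>\<epsilon>. norm (exp (complex_of_real T * (f \<epsilon> - d j)) - 1)) \<longlongrightarrow> w j) (nhds 0)"
      unfolding w_def f0[symmetric]
      using cont by (intro tendsto_intros) (simp add: continuous_at_imp_continuous_at_within isCont_def tendsto_at_iff_tendsto_nhds)
    from order_tendstoD(1)[OF this cw] show ?thesis by (rule eventually_mono) simp
  qed
  then show ?thesis by (intro that[OF c] eventually_ball_finite) auto
qed

section \<open>Multipliers of nearly diagonal systems\<close>

text \<open>
  The substitution \<open>y\<^sub>j t = exp (- A0\<^sub>j\<^sub>j t) x\<^sub>j t\<close> turns \<open>x' = A x\<close> into a system whose coefficients are
  those of \<open>A - A0\<close>, multiplied by exponentials bounded by \<open>exp (2 * norm A0 * T)\<close>. On the diagonal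
  these exponentials cancel, so the averaging hypothesis can be stated for the unscaled perturbation
  \<open>G\<close>.
\<close>

lemma nearly_diagonal_multiplier:
  fixes x :: "real \<Rightarrow> complex^'n" and A G :: "real \<Rightarrow> complex^'n^'n" and A0 :: "complex^'n^'n"
    and T \<eta> \<rho> \<kappa> c :: real
  assumes diag: "is_diagonal A0"
    and ode: "\<And>t. t \<in> {0..T} \<Longrightarrow> (x has_vector_derivative A t *v x t) (at t within {0..T})"
    and G: "\<And>t j k. t \<in> {0..T} \<Longrightarrow> norm (G t $ j $ k) \<le> \<kappa>"
    and R: "\<And>t j k. t \<in> {0..T} \<Longrightarrow> norm (A t $ j $ k - A0 $ j $ k - G t $ j $ k) \<le> \<rho>"
    and T: "0 \<le> T"
    and a: "\<And>t. t \<in> {0..T} \<Longrightarrow> (a has_vector_derivative G t $ i $ i) (at t within {0..T})"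
    and a_return: "a T = a 0"
    and \<eta>: "exp (2 * norm A0 * T) * (\<kappa> + \<rho>) \<le> \<eta>"
    and small: "2 * (CARD('n) * \<eta> * T) \<le> 1"
    and return: "x T = \<mu> *s x 0" and nonzero: "x 0 \<noteq> 0"
    and gap: "c > 0" "\<And>j. j \<noteq> i \<Longrightarrow> c \<le> norm (exp (- (A0 $ j $ j * T)) * \<mu> - 1)"
    and small_gap: "4 * (CARD('n) * \<eta> * T) \<le> c"
  shows "norm (exp (- (A0 $ i $ i * T)) * \<mu> - 1)
    \<le> 4 * T * (CARD('n) * T * (1 + 1 / c) * \<eta>\<^sup>2 + \<rho>)"
proof -
  define y where "y = (\<lambda>j t. exp (- (A0 $ j $ j * complex_of_real t)) * x t $ j)"
  define B where "B = (\<lambda>t j k. exp (- (A0 $ j $ j * complex_of_real t)) * (A t $ j $ k - A0 $ j $ k)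
      * exp (A0 $ k $ k * complex_of_real t))"
  have \<kappa>0: "\<kappa> \<ge> 0" using order_trans[OF norm_ge_zero G[of 0]] T by simp
  have \<rho>0: "\<rho> \<ge> 0" using order_trans[OF norm_ge_zero R[of 0]] T by simp
  show ?thesis
  proof (rule slow_system_multiplier[of T y B \<eta> a "\<lambda>t. G t $ i $ i" i \<rho>
        "\<lambda>j. exp (- (A0 $ j $ j * T)) * \<mu>"])
    fix j t assume t: "t \<in> {0..T}"
    have "((\<lambda>t. x t $ j) has_vector_derivative (A t *v x t) $ j) (at t within {0..T})"
      by (rule bounded_linear.has_vector_derivative[OF bounded_linear_vec_nth ode[OF t]])
    moreover have "((\<lambda>z. exp (- (A0 $ j $ j * z))) has_field_derivative
        - A0 $ j $ j * exp (- (A0 $ j $ j * of_real t))) (at (of_real t))"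
      by (auto intro!: derivative_eq_intros)
    then have "((\<lambda>t. exp (- (A0 $ j $ j * complex_of_real t))) has_vector_derivative
        - A0 $ j $ j * exp (- (A0 $ j $ j * of_real t))) (at t within {0..T})"
      by (intro has_vector_derivative_real_field)
    ultimately have dy: "(y j has_vector_derivative exp (- (A0 $ j $ j * of_real t)) * (A t *v x t) $ j
        + (- A0 $ j $ j * exp (- (A0 $ j $ j * of_real t))) * x t $ j) (at t within {0..T})"
      unfolding y_def by (intro has_vector_derivative_mult)
    have "(\<Sum>k\<in>UNIV. A0 $ j $ k * x t $ k) = (\<Sum>k\<in>UNIV. if k = j then A0 $ j $ j * x t $ j else 0)"
      using diag by (intro sum.cong) (auto simp: is_diagonal_def)
    then have diag_row: "(\<Sum>k\<in>UNIV. A0 $ j $ k * x t $ k) = A0 $ j $ j * x t $ j" by simp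
    have "(\<Sum>k\<in>UNIV. B t j k * y k t)
        = exp (- (A0 $ j $ j * of_real t)) * (\<Sum>k\<in>UNIV. (A t $ j $ k - A0 $ j $ k) * x t $ k)"
      unfolding sum_distrib_left by (intro sum.cong) (auto simp: B_def y_def exp_minus)
    also have "\<dots> = exp (- (A0 $ j $ j * of_real t)) * (A t *v x t) $ j
        + (- A0 $ j $ j * exp (- (A0 $ j $ j * of_real t))) * x t $ j"
      by (simp add: matrix_vector_mult_def left_diff_distrib sum_subtractf diag_row right_diff_distrib)
    finally show "(y j has_vector_derivative (\<Sum>k\<in>UNIV. B t j k * y k t)) (at t within {0..T})"
      using dy by simp
  next
    fix t j k assume t: "t \<in> {0..T}"
    have e: "norm (exp z) \<le> exp (norm A0 * T)" if "norm z = norm (A0 $ l $ l) * t" for z :: complex and l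
    proof -
      have "norm z \<le> norm A0 * T"
        unfolding that using t by (intro mult_mono norm_matrix_entry_le) auto
      then show ?thesis using norm_exp[of z] exp_le_cancel_iff order_trans by blast
    qed
    have "norm (A t $ j $ k - A0 $ j $ k) \<le> \<kappa> + \<rho>"
      using G[OF t, of j k] R[OF t, of j k] norm_triangle_ineq2[of "A t $ j $ k - A0 $ j $ k" "G t $ j $ k"]
      by simp
    then have "norm (B t j k) \<le> exp (norm A0 * T) * (\<kappa> + \<rho>) * exp (norm A0 * T)"
      unfolding B_def norm_mult using t \<kappa>0 \<rho>0
      by (intro mult_mono e[of _ j] e[of _ k]) (auto simp: norm_mult)
    also have "\<dots> = exp (2 * norm A0 * T) * (\<kappa> + \<rho>)"
      by (simp add: exp_add[symmetric] mult_ac)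
    finally show "norm (B t j k) \<le> \<eta>" using \<eta> by simp
  next
    fix t assume t: "t \<in> {0..T}"
    have "1 * \<kappa> \<le> exp (2 * norm A0 * T) * (\<kappa> + \<rho>)"
      using \<kappa>0 \<rho>0 T by (intro mult_mono) auto
    then show "norm (G t $ i $ i) \<le> \<eta>" using G[OF t, of i i] \<eta> by simp
    show "norm (B t i i - G t $ i $ i) \<le> \<rho>"
    proof -
      have "B t i i = A t $ i $ i - A0 $ i $ i"
        by (simp add: B_def exp_minus field_simps)
      then show ?thesis using R[OF t, of i i] by simp
    qed
  next
    show "y j T = exp (- (A0 $ j $ j * T)) * \<mu> * y j 0" for j
      by (simp add: y_def return)
    show "y (SOME l. x 0 $ l \<noteq> 0) 0 \<noteq> 0"
      using nonzero someI_ex[of "\<lambda>l. x 0 $ l \<noteq> 0"] by (auto simp: y_def vec_eq_iff)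
  qed (use T small a a_return gap small_gap in auto)
qed

section \<open>Quadratic perturbation of a simple Floquet exponent\<close>

theorem lemma4p5:
  fixes T r0 \<delta> :: real
    and A0 :: "complex^'n^'n"
    and Ac :: "nat \<Rightarrow> real \<Rightarrow> complex^'n^'n"
    and Afourier :: "nat \<Rightarrow> int \<Rightarrow> complex^'n^'n"
    and A :: "complex \<Rightarrow> real \<Rightarrow> complex^'n^'n"
    and F0 :: "complex^'n^'n"
    and Fc :: "nat \<Rightarrow> complex^'n^'n"
    and F :: "complex \<Rightarrow> complex^'n^'n"
    and Pc :: "nat \<Rightarrow> real \<Rightarrow> complex^'n^'n"
    and P X :: "complex \<Rightarrow> real \<Rightarrow> complex^'n^'n"
    and i :: 'n
    and f :: "complex \<Rightarrow> complex"
  assumes T_pos: "T > 0"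
    and r0_pos: "r0 > 0"
    and A_series: "\<And>\<epsilon>. norm \<epsilon> < r0 \<Longrightarrow>
      uniform_limit UNIV (\<lambda>k t. \<Sum>n<k. \<epsilon> ^ n *k Ac n t) (A \<epsilon>) sequentially"
    and A_periodic: "\<And>\<epsilon> t. norm \<epsilon> < r0 \<Longrightarrow> A \<epsilon> (t + T) = A \<epsilon> t"
    and A_continuous: "\<And>\<epsilon>. norm \<epsilon> < r0 \<Longrightarrow> continuous_on UNIV (A \<epsilon>)"
    and A0_constant: "\<And>t. Ac 0 t = A0"
    and A0_diagonal: "is_diagonal A0"
    and Afourier_finite: "\<And>n. n \<ge> 1 \<Longrightarrow> finite {m. Afourier n m \<noteq> 0}"
    and Ac_fourier: "\<And>n t. n \<ge> 1 \<Longrightarrow>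
      Ac n t = (\<Sum>m | Afourier n m \<noteq> 0. exp (2 * pi * \<i> * of_int m * t / T) *k Afourier n m)"
    and F0_diagonal: "is_diagonal F0"
    and F0_lattice: "\<And>j. \<exists>k::int. (A0 - F0) $ j $ j = 2 * pi * \<i> / T * of_int k"
    and F0_strip: "\<And>j. Im (F0 $ j $ j) \<in> {- pi / T <.. pi / T}"
    and \<delta>: "0 < \<delta>" "\<delta> \<le> r0"
    and X_initial: "\<And>\<epsilon>. norm \<epsilon> < \<delta> \<Longrightarrow> X \<epsilon> 0 = mat 1"
    and X_ode: "\<And>\<epsilon> t. norm \<epsilon> < \<delta> \<Longrightarrow> (X \<epsilon> has_vector_derivative A \<epsilon> t ** X \<epsilon> t) (at t)"
    and X_floquet: "\<And>\<epsilon> t. norm \<epsilon> < \<delta> \<Longrightarrow> X \<epsilon> t = P \<epsilon> t ** mexp (complex_of_real t *k F \<epsilon>)"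
    and P_periodic: "\<And>\<epsilon> t. norm \<epsilon> < \<delta> \<Longrightarrow> P \<epsilon> (t + T) = P \<epsilon> t"
    and P_initial: "\<And>\<epsilon>. norm \<epsilon> < \<delta> \<Longrightarrow> P \<epsilon> 0 = mat 1"
    and F_series: "\<And>\<epsilon>. norm \<epsilon> < \<delta> \<Longrightarrow> (\<lambda>n. \<epsilon> ^ n *k Fc n) sums F \<epsilon>"
    and P_series: "\<And>\<epsilon> t. norm \<epsilon> < \<delta> \<Longrightarrow> (\<lambda>n. \<epsilon> ^ n *k Pc n t) sums P \<epsilon> t"
    and F_zeroth: "Fc 0 = F0"
    and P_zeroth: "\<And>t. Pc 0 t = mexp (complex_of_real t *k (A0 - F0))"
    and f_eigenvalue: "\<forall>\<^sub>F \<epsilon> in nhds 0. is_eigenvalue (F \<epsilon>) (f \<epsilon>)"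
    and f_continuous: "isCont f 0"
    and f_zero: "f 0 = F0 $ i $ i"
    and simple: "\<And>j. j \<noteq> i \<Longrightarrow> F0 $ j $ j \<noteq> F0 $ i $ i"
    and A1_no_constant: "Afourier 1 0 = 0"
  shows "(\<lambda>\<epsilon>. f \<epsilon> - F0 $ i $ i) \<in> O[at 0](\<lambda>\<epsilon>. \<epsilon>\<^sup>2)"
proof -
  have Ac_bounded: "\<exists>b. \<forall>t. norm (Ac n t) \<le> b" for n
  proof (cases "n = 0")
    case True
    then show ?thesis using A0_constant by auto
  next
    case False
    have "norm (Ac n t) \<le> (\<Sum>j\<in>UNIV. \<Sum>k\<in>UNIV. \<Sum>m | Afourier n m \<noteq> 0. norm (Afourier n m $ j $ k))" for t
    proof (rule order_trans[OF norm_matrix_le_sum_entries], intro sum_mono)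
      fix j k
      show "norm (Ac n t $ j $ k) \<le> (\<Sum>m | Afourier n m \<noteq> 0. norm (Afourier n m $ j $ k))"
        using False by (subst Ac_fourier) (auto intro!: sum_norm_le simp: norm_mult norm_exp_eq_Re)
    qed
    then show ?thesis by blast
  qed
  \<comment> \<open>Matrix indices and time form one parameter, so that a single constant serves all entries.\<close>
  define g where "g = (\<lambda>n (j, k, t). Ac n t $ j $ k)"
  define h where "h = (\<lambda>\<epsilon> (j, k, t). A \<epsilon> t $ j $ k)"
  obtain C where C: "C > 0"
    and C_bound: "\<And>\<epsilon> s. norm \<epsilon> \<le> r0 / 4 \<Longrightarrow> norm (h \<epsilon> s - g 0 s - \<epsilon> * g 1 s) \<le> C * (norm \<epsilon>)\<^sup>2"
  proof (rule uniform_power_series_remainder[OF r0_pos, of g h])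
    fix \<epsilon> :: complex assume \<epsilon>: "norm \<epsilon> < r0"
    show "uniform_limit UNIV (\<lambda>k s. \<Sum>n<k. \<epsilon> ^ n * g n s) (h \<epsilon>) sequentially"
    proof (rule uniform_limitI)
      fix e :: real assume "e > 0"
      from uniform_limitD[OF A_series[OF \<epsilon>] this]
      have "\<forall>\<^sub>F p in sequentially. \<forall>t. dist (\<Sum>n<p. \<epsilon> ^ n *k Ac n t) (A \<epsilon> t) < e" by simp
      then show "\<forall>\<^sub>F p in sequentially. \<forall>s\<in>UNIV. dist (\<Sum>n<p. \<epsilon> ^ n * g n s) (h \<epsilon> s) < e"
      proof eventually_elim
        case (elim p)
        have "dist ((\<Sum>n<p. \<epsilon> ^ n *k Ac n t) $ j $ k) (A \<epsilon> t $ j $ k) < e" for j k t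
          using elim[rule_format, of t]
          by (rule le_less_trans[OF order_trans[OF dist_vec_nth_le dist_vec_nth_le]])
        then show ?case by (simp add: g_def h_def split_paired_all split: prod.split)
      qed
    qed
  next
    fix n
    obtain b where b: "\<And>t. norm (Ac n t) \<le> b" using Ac_bounded[of n] by metis
    have "norm (g n s) \<le> b" for s
      by (cases s) (simp add: g_def order_trans[OF norm_matrix_entry_le b])
    then show "\<exists>b. \<forall>s. norm (g n s) \<le> b" by blast
  qed (rule that)
  obtain K where K: "\<And>t. norm (Ac 1 t) \<le> K" using Ac_bounded[of 1] by metis
  have zero_mode: "0 \<notin> {m. Afourier 1 m \<noteq> 0}" using A1_no_constant by simp
  obtain a where a: "\<And>t. (a has_vector_derivative
        (\<Sum>m | Afourier 1 m \<noteq> 0. exp (2 * pi * \<i> * of_int m * t / T) * Afourier 1 m $ i $ i)) (at t)"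
    and a_return: "a T = a 0"
    by (rule trigonometric_polynomial_primitive[OF T_pos zero_mode, of "\<lambda>m. Afourier 1 m $ i $ i"]) blast
  have a: "(a has_vector_derivative Ac 1 t $ i $ i) (at t)" for t
    using a[of t] by (simp add: Ac_fourier)
  obtain c where c: "c > 0" and gap: "\<forall>\<^sub>F \<epsilon> in nhds 0. \<forall>j\<in>-{i}.
      c \<le> norm (exp (complex_of_real T * (f \<epsilon> - F0 $ j $ j)) - 1)"
    by (rule exp_multiplier_gap[of T f "\<lambda>j. F0 $ j $ j" i])
      (use T_pos f_continuous f_zero F0_strip simple in blast)+
  \<comment> \<open>Over a full period the exponentials of \<open>A0\<close> and \<open>F0\<close> agree.\<close>
  have multiplier: "exp (- (A0 $ j $ j * T)) * exp (of_real T * z) = exp (of_real T * (z - F0 $ j $ j))" for j z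
  proof -
    obtain k :: int where "(A0 - F0) $ j $ j = 2 * pi * \<i> / T * of_int k" using F0_lattice by blast
    then have "A0 $ j $ j * T = F0 $ j $ j * T + 2 * of_int k * pi * \<i>"
      using T_pos by (simp add: field_simps)
    moreover have "exp (2 * complex_of_int k * pi * \<i>) = 1"
      using exp_integer_2pi[of "of_int k"] by simp
    ultimately show ?thesis by (simp add: exp_minus exp_add exp_diff right_diff_distrib field_simps)
  qed
  define D where "D = exp (2 * norm A0 * T) * (K + C)"
  define L where "L = 4 * T * (CARD('n) * T * (1 + 1 / c) * D\<^sup>2 + C)"
  obtain r where r: "r > 0" "\<And>w::complex. norm w < r \<Longrightarrow> norm w \<le> 2 * norm (exp w - 1)"
    by (rule norm_le_norm_exp_minus_one) blast
  have r0_quarter: "r0 / 4 > 0" using r0_pos by simp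
  have small: "\<forall>\<^sub>F \<epsilon>::complex in nhds 0. M * norm \<epsilon> < s" if "s > 0" for M s :: real
  proof (rule order_tendstoD(2))
    show "((\<lambda>\<epsilon>::complex. M * norm \<epsilon>) \<longlongrightarrow> M * norm (0::complex)) (nhds 0)"
      by (intro tendsto_intros filterlim_ident)
  qed (use that in simp)
  have "((\<lambda>\<epsilon>. norm (complex_of_real T * (f \<epsilon> - F0 $ i $ i))) \<longlongrightarrow> norm (complex_of_real T * (f 0 - F0 $ i $ i))) (nhds 0)"
    using f_continuous by (intro tendsto_intros) (simp add: isCont_def tendsto_at_iff_tendsto_nhds)
  then have close: "\<forall>\<^sub>F \<epsilon> in nhds 0. norm (complex_of_real T * (f \<epsilon> - F0 $ i $ i)) < r"
    by (rule order_tendstoD(2)) (simp add: f_zero r(1))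
  have "\<forall>\<^sub>F \<epsilon> in nhds 0. norm (f \<epsilon> - F0 $ i $ i) \<le> 2 * L / T * norm (\<epsilon>\<^sup>2)"
    using f_eigenvalue gap close small[OF \<delta>(1), of 1] small[OF zero_less_one, of 1]
      small[OF r0_quarter, of 1]
      small[OF zero_less_one, of "2 * (CARD('n) * D * T)"] small[OF c, of "4 * (CARD('n) * D * T)"]
  proof eventually_elim
    case (elim \<epsilon>)
    have \<epsilon>: "norm \<epsilon> < \<delta>" "norm \<epsilon> \<le> 1" "norm \<epsilon> \<le> r0 / 4"
      and \<epsilon>_small: "2 * (CARD('n) * (D * norm \<epsilon>) * T) \<le> 1" "4 * (CARD('n) * (D * norm \<epsilon>) * T) \<le> c"
      using elim(4-8) r0_pos c by (simp_all add: mult_ac)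
    obtain v where v: "v \<noteq> 0" "F \<epsilon> *v v = f \<epsilon> *s v"
      using elim(1) by (auto simp: is_eigenvalue_def)
    have "norm (exp (- (A0 $ i $ i * T)) * exp (of_real T * f \<epsilon>) - 1)
        \<le> 4 * T * (CARD('n) * T * (1 + 1 / c) * (D * norm \<epsilon>)\<^sup>2 + C * (norm \<epsilon>)\<^sup>2)"
    proof (rule nearly_diagonal_multiplier[where x = "\<lambda>t. X \<epsilon> t *v v" and A = "A \<epsilon>"
          and G = "\<lambda>t. \<epsilon> *k Ac 1 t" and \<kappa> = "K * norm \<epsilon>" and a = "\<lambda>t. \<epsilon> * a t"])
      show "((\<lambda>t. X \<epsilon> t *v v) has_vector_derivative A \<epsilon> t *v (X \<epsilon> t *v v)) (at t within {0..T})" for t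
      proof -
        have "((\<lambda>t. X \<epsilon> t *v v) has_vector_derivative (A \<epsilon> t ** X \<epsilon> t) *v v) (at t within {0..T})"
          using X_ode[OF \<epsilon>(1)] by (intro bounded_linear.has_vector_derivative[OF bounded_linear_matrix_vector_mult_left])
             (rule has_vector_derivative_at_within)
        then show ?thesis by (simp add: matrix_vector_mul_assoc)
      qed
      show "norm ((\<epsilon> *k Ac 1 t) $ j $ k) \<le> K * norm \<epsilon>" for t j k
        using order_trans[OF norm_matrix_entry_le K] by (simp add: norm_mult mult.commute[of K] mult_left_mono)
      show "norm (A \<epsilon> t $ j $ k - A0 $ j $ k - (\<epsilon> *k Ac 1 t) $ j $ k) \<le> C * (norm \<epsilon>)\<^sup>2" for t j k
        using C_bound[OF \<epsilon>(3), of "(j, k, t)"] by (simp add: g_def h_def A0_constant)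
      show "((\<lambda>t. \<epsilon> * a t) has_vector_derivative (\<epsilon> *k Ac 1 t) $ i $ i) (at t within {0..T})" for t
        using has_vector_derivative_mult_right[OF has_vector_derivative_at_within[OF a]] by simp
      have "(norm \<epsilon>)\<^sup>2 \<le> norm \<epsilon>" using \<epsilon>(2) by (simp add: power2_eq_square mult_left_le)
      then have "K * norm \<epsilon> + C * (norm \<epsilon>)\<^sup>2 \<le> (K + C) * norm \<epsilon>"
        using C by (simp add: distrib_right)
      then show "exp (2 * norm A0 * T) * (K * norm \<epsilon> + C * (norm \<epsilon>)\<^sup>2) \<le> D * norm \<epsilon>"
        by (simp add: D_def mult.assoc)
      have "(complex_of_real T *k F \<epsilon>) *v v = complex_of_real T *s (F \<epsilon> *v v)"
        by (simp add: matrix_vector_mult_def vec_eq_iff sum_distrib_left mult.assoc)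
      then have "mexp (complex_of_real T *k F \<epsilon>) *v v = exp (of_real T * f \<epsilon>) *s v"
        by (intro mexp_eigenvector) (simp add: v(2) vector_smult_assoc)
      moreover have "P \<epsilon> T = mat 1"
        using P_periodic[OF \<epsilon>(1), of 0] P_initial[OF \<epsilon>(1)] by simp
      ultimately show "X \<epsilon> T *v v = exp (of_real T * f \<epsilon>) *s (X \<epsilon> 0 *v v)"
        by (simp add: X_floquet[OF \<epsilon>(1), of T] X_initial[OF \<epsilon>(1)])
      show "X \<epsilon> 0 *v v \<noteq> 0" using v(1) by (simp add: X_initial[OF \<epsilon>(1)])
      show "c \<le> norm (exp (- (A0 $ j $ j * T)) * exp (of_real T * f \<epsilon>) - 1)" if "j \<noteq> i" for j
        using elim(2) that by (simp add: multiplier)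
    qed (use A0_diagonal T_pos a_return c \<epsilon>_small in simp_all)
    also have "\<dots> = L * norm (\<epsilon>\<^sup>2)"
      by (simp add: L_def norm_power power_mult_distrib algebra_simps)
    finally have "norm (exp (of_real T * (f \<epsilon> - F0 $ i $ i)) - 1) \<le> L * norm (\<epsilon>\<^sup>2)"
      by (simp only: multiplier)
    with r(2)[OF elim(3)] have "T * norm (f \<epsilon> - F0 $ i $ i) \<le> 2 * (L * norm (\<epsilon>\<^sup>2))"
      using T_pos by (simp add: norm_mult)
    then show ?case using T_pos by (simp add: field_simps)
  qed
  then show ?thesis
    by (intro bigoI[of _ "2 * L / T"]) (auto simp: eventually_at_filter elim: eventually_mono)
qed

end
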